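(* Let $\lambda$ be any ordinal and let $\kappa = |\lambda| + \aleph_0$. Let $\mathbb{P} = \{p_i : i < (2^\kappa)^+\}$ be a set of propositional variables with $|\mathbb{P}| = (2^\kappa)^+$, and let \[ \Gamma = \{\Diamond p_i : i < (2^\kappa)^+\} \cup \{\Box(p_i \to \Diamond p_j) : i < j < (2^\kappa)^+\}. \] Then for no ordinal $\Theta$ is $\Gamma$ satisfiable in the space $(\Theta, \mathcal{I}_\lambda)$, and for no ordinal $\Theta$ is $\Gamma$ satisfiable in the space $(\Theta, {\tau_c}_{+\lambda})$. That is, there is no topological model based on either of these spaces and no point of it at which all formulas of $\Gamma$ hold simultaneously.
   Context: Formulas of $\mathcal{L}(\mathbb{P})$ are built from the variables in $\mathbb{P}$ with $\neg, \wedge, \Box$; $\Diamond = \neg\Box\neg$. A topological model on a space $(X,\tau)$ is a valuation $[\![\cdot]\!] : \mathbb{P} \to \mathcal{P}(X)$, extended Booleanly, with $[\![\Diamond\varphi]\!] = d([\![\varphi]\!])$. Here $d(A)$ is the set of limit points of $A$, i.e. the $x$ such that every open neighbourhood $U$ of $x$ meets $A \setminus \{x\}$. A set of formulas is satisfiable in $(X,\tau)$ if there are such a model and a point $x$ lying in $[\![\varphi]\!]$ for all $\varphi$ in the set. End logarithm: $\ell(0) = 0$, and for $\xi > 0$, $\ell(\xi)$ is the unique $\beta$ with $\xi = \alpha + \omega^\beta$ for some $\alpha$. The exponential is $e(\xi) = -1 + \omega^\xi$. The hyperlogarithms $(\ell^\xi)_{\xi \in \mathrm{Ord}}$ are the unique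 family of initial functions on ordinals with $\ell^1 = \ell$ and $\ell^{\alpha+\beta} = \ell^\beta \circ \ell^\alpha$ which is pointwise maximal among families satisfying these two conditions; $\ell^0$ is the identity. Left topology $\mathcal{I}_0$ on an ordinal $\Theta$: generated by the sets $[0,\beta]$. Its Cantor–Bendixson rank is $\rho(\theta) = \theta$. The generalized Icard topology $\mathcal{I}_\lambda$ on $\Theta$ is the least topology containing $\mathcal{I}_0$ and all sets $\{\theta < \Theta : \alpha < \ell^\xi\theta \le \beta\}$, for $-1 \le \alpha < \beta \le \Theta$ and $\xi < \lambda$ (here $-1 < x$ holds for every ordinal $x$). Club topology $\tau_c$ on $\Theta$: $U \subseteq \Theta$ is open iff for every $\alpha \in U$ with $\mathrm{cf}(\alpha) > \omega$, the set $U \cap \alpha$ contains a closed unbounded subset of $\alpha$. Points of countable cofinality, including $0$ and successors, are isolated. Let $\rho_{\tau_c}$ be the Cantor–Bendixson rank in $\tau_c$: the least $\xi$ with $x \notin d^{\xi+1}(\Theta)$, where $d^0 A = A$, $d^{\xi+1}A = d(d^\xi A)$, and $d^\alpha A = \bigcap_{\xi<\alpha} d^\xi A$ for limit $\alpha$. Then ${\tau_c}_{+\lambda}$ is the least topology on $\Theta$ containing $\tau_c$ and all sets $\{x : \alpha < \ell^\xi \rho_{\tau_c}(x) \le \beta\}$, for $-1 \le \alpha < \beta \le \Theta$ and $\xi < \lambda$. *)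

theory Defs
  imports "HOL-Analysis.Analysis" "HOL-Library.Option_ord"
begin

unbundle cardinal_syntax

no_notation elt_set_eq (infix \<open>=o\<close> 50)

section \<open>Ordinals\<close>

text \<open>
  There is no type of all ordinals in HOL. The elements of \<open>'a ordinal\<close> are the ordinals below
  the initial ordinal \<open>\<mu>\<^sup>+\<close>, where \<open>\<mu>\<close> is the (infinite) cardinality of \<open>'a + nat\<close>. Since
  \<open>\<mu>\<^sup>+\<close> is regular and uncountable, all suprema taken below exist
  (lemma \<open>small_bounded\<close>) and the ordinal arithmetic agrees with the one on the class of all
  ordinals. Every well-order on a set of cardinality at most \<open>\<mu>\<close>, on whatever type, is the order
  type of \<open>{..<a}\<close> for some \<open>a\<close> (lemma \<open>ordinal_represents\<close>), so a statement about arbitrary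
  ordinals is a statement about \<open>'a ordinal\<close> for arbitrary \<open>'a\<close>.
\<close>

typedef 'a ordinal = "Field (cardSuc |UNIV :: ('a + nat) set| )"
proof -
  let ?r = "|UNIV :: ('a + nat) set|"
  have "\<not> finite (Field (cardSuc ?r))"
    by (simp add: card_of_cardSuc_finite)
  then have "Field (cardSuc ?r) \<noteq> {}" by auto
  then show ?thesis by blast
qed

lemma Well_order_cardSuc_UNIV: "Well_order (cardSuc |UNIV :: ('a + nat) set| )"
  using cardSuc_Card_order[OF card_of_Card_order] card_order_on_well_order_on by blast

instantiation ordinal :: (type) wellorder
begin

definition less_eq_ordinal :: "'a ordinal \<Rightarrow> 'a ordinal \<Rightarrow> bool" where
  "a \<le> b \<longleftrightarrow> (Rep_ordinal a, Rep_ordinal b) \<in> cardSuc |UNIV :: ('a + nat) set|"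

definition less_ordinal :: "'a ordinal \<Rightarrow> 'a ordinal \<Rightarrow> bool" where
  "a < b \<longleftrightarrow> a \<le> b \<and> a \<noteq> (b :: 'a ordinal)"

instance
proof
  let ?r = "cardSuc |UNIV :: ('a + nat) set|"
  note W = Well_order_cardSuc_UNIV[where 'a = 'a]
  have refl: "refl_on (Field ?r) ?r" and tr: "trans ?r" and an: "antisym ?r"
    and tot: "total_on (Field ?r) ?r" and wf: "wf (?r - Id)"
    using W by (auto simp: well_order_on_def linear_order_on_def partial_order_on_def
        preorder_on_def)
  fix x y z :: "'a ordinal"
  show r: "x \<le> x"
    using refl Rep_ordinal[of x] by (auto simp: less_eq_ordinal_def refl_on_def)
  show "x \<le> z" if "x \<le> y" "y \<le> z"
    using that tr unfolding less_eq_ordinal_def by (meson transD)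
  show a: "x = y" if "x \<le> y" "y \<le> x"
    using that an unfolding less_eq_ordinal_def by (meson Rep_ordinal_inject antisymD)
  then show "x < y \<longleftrightarrow> x \<le> y \<and> \<not> y \<le> x"
    using r by (auto simp: less_ordinal_def)
  show "x \<le> y \<or> y \<le> x"
    using tot r Rep_ordinal[of x] Rep_ordinal[of y] unfolding less_eq_ordinal_def total_on_def
    by (metis Rep_ordinal_inject)
  fix P :: "'a ordinal \<Rightarrow> bool" and c
  assume step: "\<And>x. (\<And>y. y < x \<Longrightarrow> P y) \<Longrightarrow> P x"
  have "wf (inv_image (?r - Id) Rep_ordinal)"
    using wf by (rule wf_inv_image)
  then show "P c"
    by (rule wf_induct_rule)
      (rule step, auto simp: less_ordinal_def less_eq_ordinal_def Rep_ordinal_inject)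
qed

end

lemma small_bounded:
  fixes A :: "'a ordinal set"
  assumes "|A| \<le>o |UNIV :: ('a + nat) set|"
  shows "\<exists>b. \<forall>x\<in>A. x \<le> b"
proof -
  let ?r = "|UNIV :: ('a + nat) set|"
  have chain: "relChain (cardSuc ?r) (\<lambda>i. {j. (j, i) \<in> cardSuc ?r})"
    using Well_order_cardSuc_UNIV[where 'a = 'a]
    by (auto simp: relChain_def well_order_on_def linear_order_on_def partial_order_on_def
        preorder_on_def dest: transD)
  have "Rep_ordinal ` A \<subseteq> (\<Union>i\<in>Field (cardSuc ?r). {j. (j, i) \<in> cardSuc ?r})"
    by (auto intro!: bexI[OF _ Rep_ordinal] simp: less_eq_ordinal_def[symmetric])
  moreover have "|Rep_ordinal ` A| \<le>o ?r"
    using assms card_of_image ordLeq_transitive by blast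
  ultimately obtain i where "i \<in> Field (cardSuc ?r)" "Rep_ordinal ` A \<subseteq> {j. (j, i) \<in> cardSuc ?r}"
    using cardSuc_UNION[OF card_of_Card_order _ chain, of "Rep_ordinal ` A"]
    by (auto simp: Field_card_of simp del: image_subset_iff)
  then show ?thesis
    by (intro exI[of _ "Abs_ordinal i"]) (auto simp: less_eq_ordinal_def Abs_ordinal_inverse)
qed

lemma ordinal_represents:
  fixes r :: "'b rel"
  assumes "Well_order r" "|Field r| \<le>o |UNIV :: ('a + nat) set|"
  shows "\<exists>a :: 'a ordinal. r =o {(x, y). x \<le> y \<and> y < a}"
proof -
  let ?s = "cardSuc |UNIV :: ('a + nat) set|"
  note W = Well_order_cardSuc_UNIV[where 'a = 'a]
  have C: "Card_order ?s"
    by (simp add: cardSuc_Card_order card_of_Card_order)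
  have "r <o ?s"
  proof (rule ccontr)
    assume "\<not> r <o ?s"
    then have "|Field ?s| \<le>o |Field r|"
      using assms(1) W by (simp add: not_ordLess_iff_ordLeq card_of_mono2)
    then have "?s \<le>o |UNIV :: ('a + nat) set|"
      using assms(2) C by (meson card_of_Field_ordIso ordIso_ordLeq_trans ordIso_symmetric
          ordLeq_transitive)
    then show False
      using cardSuc_greater[OF card_of_Card_order, where 'a = "'a + nat"] not_ordLess_ordLeq
      by blast
  qed
  then obtain k where k: "k \<in> Field ?s" and iso: "r =o Restr ?s (underS ?s k)"
    using assms(1) W by (auto simp: ordLess_iff_ordIso_Restr)
  define a where "a = (Abs_ordinal k :: 'a ordinal)"
  have ka: "k = Rep_ordinal a"
    using k by (simp add: a_def Abs_ordinal_inverse)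
  let ?t = "{(x, y). x \<le> y \<and> y < a}"
  have Rep_less: "x < y \<longleftrightarrow> Rep_ordinal x \<noteq> Rep_ordinal y \<and> (Rep_ordinal x, Rep_ordinal y) \<in> ?s"
    for x y :: "'a ordinal"
    by (auto simp: less_ordinal_def less_eq_ordinal_def Rep_ordinal_inject)
  have us: "underS ?s k = Rep_ordinal ` {..<a}"
  proof (intro equalityI subsetI)
    fix x assume x: "x \<in> underS ?s k"
    then have "x \<in> Field ?s" by (auto simp: underS_def intro: FieldI1)
    then obtain y :: "'a ordinal" where "x = Rep_ordinal y" by (metis Abs_ordinal_inverse)
    with x show "x \<in> Rep_ordinal ` {..<a}" by (auto simp: underS_def ka Rep_less)
  qed (auto simp: underS_def ka Rep_less)
  have Ft: "Field ?t = {..<a}"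
    by (auto simp: Field_def)
  have "Restr ?s (underS ?s k) = dir_image ?t Rep_ordinal"
    unfolding us dir_image_def
    by (auto simp: less_eq_ordinal_def[symmetric] Rep_ordinal_inject dest: order.strict_trans1)
  moreover have "Well_order ?t"
  proof -
    have "?t - Id \<subseteq> {(x, y). x < y}" by auto
    then have "wf (?t - Id)" using wf wf_subset by blast
    then show ?thesis
      unfolding well_order_on_def linear_order_on_def partial_order_on_def preorder_on_def
        refl_on_def total_on_def Ft
      by (auto intro!: transI antisymI)
  qed
  moreover have "inj_on Rep_ordinal (Field ?t)"
    by (simp add: inj_on_def Rep_ordinal_inject)
  ultimately have "?t =o Restr ?s (underS ?s k)"
    using dir_image_ordIso[of ?t Rep_ordinal] by simp
  then show ?thesis using iso ordIso_symmetric ordIso_transitive by blast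
qed

instantiation ordinal :: (type) zero
begin
definition "0 = (LEAST a :: 'a ordinal. True)"
instance ..
end

definition osuc :: "'a ordinal \<Rightarrow> 'a ordinal" where
  "osuc a = (LEAST b. a < b)"

definition osup :: "'a ordinal set \<Rightarrow> 'a ordinal" where
  "osup A = (LEAST b. \<forall>a\<in>A. a \<le> b)"

definition is_limit :: "'a ordinal \<Rightarrow> bool" where
  "is_limit a \<longleftrightarrow> a \<noteq> 0 \<and> (\<nexists>b. a = osuc b)"

lemma zero_le_ordinal [simp]: "0 \<le> (a :: 'a ordinal)"
  by (simp add: zero_ordinal_def Least_le)

lemma osuc_greater: "a < osuc a"
proof -
  let ?r = "|UNIV :: ('a + nat) set|"
  have "\<exists>b. a < b"
  proof (rule ccontr)
    assume "\<nexists>b. a < b"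
    then have "UNIV = {..a}" by (auto simp: not_less)
    then have *: "Field (cardSuc ?r) = {j. (j, Rep_ordinal a) \<in> cardSuc ?r}"
      by (auto simp: set_eq_iff less_eq_ordinal_def FieldI1) (metis Abs_ordinal_inverse)
    have "Card_order (cardSuc ?r)" "\<not> finite (Field (cardSuc ?r))"
      by (simp_all add: cardSuc_Card_order card_of_Card_order card_of_cardSuc_finite)
    then show False
      using * infinite_Card_order_limit[of "cardSuc ?r" "Rep_ordinal a"] Rep_ordinal[of a]
        Well_order_cardSuc_UNIV[where 'a = 'a]
      by (auto simp: well_order_on_def linear_order_on_def partial_order_on_def
          dest: antisymD)
  qed
  then show ?thesis unfolding osuc_def by (rule LeastI_ex)
qed

lemma osuc_le_iff: "osuc a \<le> b \<longleftrightarrow> a < b"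
  using osuc_greater by (auto simp: osuc_def intro: Least_le less_le_trans)

lemma osuc_inject [simp]: "osuc a = osuc b \<longleftrightarrow> a = b"
  by (metis osuc_le_iff osuc_greater order.refl not_less_iff_gr_or_eq leD less_le_trans)

lemma osup_le_iff:
  fixes A :: "'a ordinal set"
  assumes "|A| \<le>o |UNIV :: ('a + nat) set|"
  shows "osup A \<le> b \<longleftrightarrow> (\<forall>a\<in>A. a \<le> b)"
proof -
  have "\<forall>a\<in>A. a \<le> osup A"
    unfolding osup_def using small_bounded[OF assms] by (rule LeastI_ex)
  then show ?thesis by (auto simp: osup_def intro: Least_le)
qed

text \<open>Transfinite recursion; at a limit \<open>a\<close>, the operation \<open>L\<close> is applied to the set of all
  earlier values.\<close>

function ord_rec :: "'b \<Rightarrow> ('b \<Rightarrow> 'b) \<Rightarrow> ('b set \<Rightarrow> 'b) \<Rightarrow> 'a ordinal \<Rightarrow> 'b" where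
  "ord_rec z s L a =
    (if a = 0 then z
     else if \<exists>b. a = osuc b then s (ord_rec z s L (THE b. a = osuc b))
     else L (ord_rec z s L ` {..<a}))"
  by pat_completeness auto
termination
  by (relation "inv_image {(a, b). a < b} (\<lambda>(z, s, L, a). a)")
    (auto simp: osuc_greater intro!: wf)

declare ord_rec.simps [simp del]

lemma ord_rec_0: "ord_rec z s L 0 = z"
  by (simp add: ord_rec.simps)

lemma ord_rec_osuc: "ord_rec z s L (osuc a) = s (ord_rec z s L a)"
proof -
  have "osuc a \<noteq> 0" using osuc_greater[of a] by (metis leD zero_le_ordinal)
  then show ?thesis by (subst ord_rec.simps) simp
qed

lemma ord_rec_limit: "is_limit a \<Longrightarrow> ord_rec z s L a = L (ord_rec z s L ` {..<a})"
  by (subst ord_rec.simps) (auto simp: is_limit_def)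

instantiation ordinal :: (type) "{one, plus, times}"
begin
definition "1 = osuc (0 :: 'a ordinal)"
definition "a + b = ord_rec a osuc osup (b :: 'a ordinal)"
definition "a * b = ord_rec 0 (\<lambda>x. x + a) osup (b :: 'a ordinal)"
instance ..
end

definition omega :: "'a ordinal" where
  "omega = (LEAST a. is_limit a)"

definition omega_exp :: "'a ordinal \<Rightarrow> 'a ordinal" where
  "omega_exp b = ord_rec 1 (\<lambda>x. x * omega) osup b"

definition cofinality :: "'a ordinal \<Rightarrow> 'a ordinal" where
  "cofinality a =
    (LEAST d. \<exists>f :: 'a ordinal \<Rightarrow> 'a ordinal. f ` {..<d} \<subseteq> {..<a} \<and> (\<forall>b<a. \<exists>c<d. b \<le> f c))"

section \<open>Hyperlogarithms\<close>

definition end_log :: "'a ordinal \<Rightarrow> 'a ordinal" where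
  "end_log x = (if x = 0 then 0 else (THE b. \<exists>a. x = a + omega_exp b))"

text \<open>
  An initial function \<open>f\<close> maps initial segments onto initial segments; in particular \<open>f x \<le> x\<close>, so
  that a family of initial functions on all ordinals restricts to \<open>'a ordinal\<close>. The maximal family
  on \<open>'a ordinal\<close> is the restriction of the one on all ordinals. Maximality is among families of
  initial functions; without this requirement no maximum exists.
\<close>

definition initial_function :: "('a ordinal \<Rightarrow> 'a ordinal) \<Rightarrow> bool" where
  "initial_function f \<longleftrightarrow> (\<forall>b. \<exists>c. f ` {..<b} = {..<c})"

definition hyperlog_family :: "('a ordinal \<Rightarrow> 'a ordinal \<Rightarrow> 'a ordinal) \<Rightarrow> bool" where
  "hyperlog_family g \<longleftrightarrow>
    (\<forall>x. initial_function (g x)) \<and> g 1 = end_log \<and> (\<forall>a b. g (a + b) = g b \<circ> g a)"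

definition hyperlog :: "'a ordinal \<Rightarrow> 'a ordinal \<Rightarrow> 'a ordinal" where
  "hyperlog =
    (THE g. hyperlog_family g \<and> g 0 = id \<and> (\<forall>h. hyperlog_family h \<longrightarrow> (\<forall>x t. h x t \<le> g x t)))"

section \<open>Topologies on an ordinal\<close>

text \<open>All topologies on \<open>\<Theta>\<close> have underlying set \<open>{..<\<Theta>}\<close>. In the subbasic sets below the lower
  bound \<open>\<alpha>\<close> ranges over \<open>'a ordinal option\<close>, with \<open>None\<close> in the role of \<open>-1\<close>: in the library order
  on \<open>option\<close>, \<open>None\<close> lies below every \<open>Some x\<close>.\<close>

definition hyperlog_intervals ::
    "'a ordinal \<Rightarrow> 'a ordinal \<Rightarrow> ('a ordinal \<Rightarrow> 'a ordinal) \<Rightarrow> 'a ordinal set set" where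
  "hyperlog_intervals lam \<Theta> rk =
    {{t. t < \<Theta> \<and> \<alpha> < Some (hyperlog \<xi> (rk t)) \<and> hyperlog \<xi> (rk t) \<le> \<beta>} | \<alpha> \<beta> \<xi>.
      \<alpha> < Some \<beta> \<and> \<beta> \<le> \<Theta> \<and> \<xi> < lam}"

definition left_topology :: "'a ordinal \<Rightarrow> 'a ordinal topology" where
  "left_topology \<Theta> = topology_generated_by {{..\<beta>} | \<beta>. \<beta> < \<Theta>}"

definition icard_topology :: "'a ordinal \<Rightarrow> 'a ordinal \<Rightarrow> 'a ordinal topology" where
  "icard_topology lam \<Theta> = topology_generated_by
    (Collect (openin (left_topology \<Theta>)) \<union> hyperlog_intervals lam \<Theta> (\<lambda>t. t))"

definition club_in :: "'a ordinal set \<Rightarrow> 'a ordinal \<Rightarrow> bool" where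
  "club_in C a \<longleftrightarrow> C \<subseteq> {..<a} \<and> (\<forall>b<a. \<exists>c\<in>C. b \<le> c) \<and>
    (\<forall>b<a. is_limit b \<and> (\<forall>c<b. \<exists>e\<in>C. c \<le> e \<and> e < b) \<longrightarrow> b \<in> C)"

definition club_topology :: "'a ordinal \<Rightarrow> 'a ordinal topology" where
  "club_topology \<Theta> = topology (\<lambda>U. U \<subseteq> {..<\<Theta>} \<and>
    (\<forall>a\<in>U. omega < cofinality a \<longrightarrow> (\<exists>C. club_in C a \<and> C \<subseteq> U \<inter> {..<a})))"

definition iter_derived :: "'b topology \<Rightarrow> 'b set \<Rightarrow> 'a ordinal \<Rightarrow> 'b set" where
  "iter_derived X A \<xi> = ord_rec A (\<lambda>B. X derived_set_of B) Inter \<xi>"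

text \<open>The rank is only meant for points of the space; in \<open>club_topology\<close> it is at most the point
  itself, so that the ordinals in \<open>'a ordinal\<close> suffice.\<close>

definition cb_rank :: "'a ordinal topology \<Rightarrow> 'a ordinal \<Rightarrow> 'a ordinal" where
  "cb_rank X x = (LEAST \<xi>. x \<notin> iter_derived X (topspace X) (osuc \<xi>))"

definition club_plus_topology :: "'a ordinal \<Rightarrow> 'a ordinal \<Rightarrow> 'a ordinal topology" where
  "club_plus_topology lam \<Theta> = topology_generated_by
    (Collect (openin (club_topology \<Theta>)) \<union>
      hyperlog_intervals lam \<Theta> (cb_rank (club_topology \<Theta>)))"

section \<open>Modal formulas and topological semantics\<close>

datatype 'v form = Var 'v | Neg "'v form" | Conj "'v form" "'v form" | Box "'v form"

definition Dia :: "'v form \<Rightarrow> 'v form" where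
  "Dia \<phi> = Neg (Box (Neg \<phi>))"

definition Imp :: "'v form \<Rightarrow> 'v form \<Rightarrow> 'v form" where
  "Imp \<phi> \<psi> = Neg (Conj \<phi> (Neg \<psi>))"

text \<open>The clause for \<open>Box\<close> is the one dictated by \<open>truth_set_Dia\<close>.\<close>

primrec truth_set :: "'b topology \<Rightarrow> ('v \<Rightarrow> 'b set) \<Rightarrow> 'v form \<Rightarrow> 'b set" where
  "truth_set X V (Var p) = V p"
| "truth_set X V (Neg \<phi>) = topspace X - truth_set X V \<phi>"
| "truth_set X V (Conj \<phi> \<psi>) = truth_set X V \<phi> \<inter> truth_set X V \<psi>"
| "truth_set X V (Box \<phi>) = topspace X - X derived_set_of (topspace X - truth_set X V \<phi>)"

lemma truth_set_subset: "(\<And>p. V p \<subseteq> topspace X) \<Longrightarrow> truth_set X V \<phi> \<subseteq> topspace X"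
  by (induction \<phi>) auto

lemma truth_set_Dia:
  assumes "\<And>p. V p \<subseteq> topspace X"
  shows "truth_set X V (Dia \<phi>) = X derived_set_of (truth_set X V \<phi>)"
  using truth_set_subset[of V X \<phi>] assms derived_set_of_subset_topspace[of X "truth_set X V \<phi>"]
  by (simp add: Dia_def double_diff)

definition satisfiable :: "'b topology \<Rightarrow> 'v form set \<Rightarrow> bool" where
  "satisfiable X \<Gamma> \<longleftrightarrow>
    (\<exists>V. (\<forall>p. V p \<subseteq> topspace X) \<and> (\<exists>x\<in>topspace X. \<forall>\<phi>\<in>\<Gamma>. x \<in> truth_set X V \<phi>))"

text \<open>The set \<open>\<Gamma>\<close> for variables \<open>p i\<close> indexed by the field of a well-order \<open>r\<close>.\<close>

definition Gamma_fms :: "'i rel \<Rightarrow> ('i \<Rightarrow> 'v) \<Rightarrow> 'v form set" where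
  "Gamma_fms r p = {Dia (Var (p i)) | i. i \<in> Field r} \<union>
    {Box (Imp (Var (p i)) (Dia (Var (p j)))) | i j. (i, j) \<in> r \<and> i \<noteq> j}"

end

theory Submission
  imports Defs
begin

text \<open>
  Fix a point \<open>x\<close> satisfying \<open>\<Gamma>\<close>, and let \<open>U\<^sub>i\<^sub>j\<close> be a neighbourhood of \<open>x\<close> witnessing the box formula
  for \<open>i < j\<close>. All basic neighbourhoods of \<open>x\<close> can be coloured with \<open>\<kappa>\<close> colours in such a way that
  any countably many of the same colour contain a common neighbourhood: the base topology (left or
  club) is closed under countable intersections of open sets, a basic set restricts only finitely many
  of the coordinates \<open>\<xi> < \<lambda>\<close>, and a lower bound in a coordinate can be taken from a fixed countable
  cofinal sequence, or else countably many lower bounds stay bounded strictly below the coordinate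
  of \<open>x\<close>. The proof of the Erdos--Rado theorem yields an ascending sequence of indices whose
  consecutive pairs have one colour, hence one neighbourhood \<open>V\<close> of \<open>x\<close> that works for all of them.
  Following the diamonds inside \<open>V\<close> and inside the open sets \<open>[0, y]\<close> then gives an infinite descending
  sequence of ordinals. No property of the hyperlogarithms or of the Cantor--Bendixson rank matters.
\<close>

section \<open>Homogeneous ascending sequences\<close>

text \<open>Deleting the minimum again and again leaves infinite sets \<open>D n\<close>; their
  successive minima ascend.\<close>

lemma ascending_sequence_in_infinite_set:
  assumes "Well_order r" "T \<subseteq> Field r" "infinite T"
  shows "\<exists>s :: nat \<Rightarrow> 'i. range s \<subseteq> T \<and> (\<forall>n. (s n, s (Suc n)) \<in> r - Id)"
proof -
  define m where "m A = (SOME a. a \<in> A \<and> (\<forall>b\<in>A. (a, b) \<in> r))" for A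
  have m: "m A \<in> A \<and> (\<forall>b\<in>A. (m A, b) \<in> r)" if "A \<subseteq> Field r" "A \<noteq> {}" for A
  proof -
    have "\<exists>a. a \<in> A \<and> (\<forall>b\<in>A. (a, b) \<in> r)"
      using assms(1) that by (meson wo_rel.Well_order_isMinim_exists wo_rel.isMinim_def wo_rel.intro)
    then show ?thesis unfolding m_def by (rule someI_ex)
  qed
  define D where "D = rec_nat T (\<lambda>_ A. A - {m A})"
  have D: "D n \<subseteq> T \<and> infinite (D n)" for n
    by (induction n) (use assms(3) in \<open>auto simp: D_def\<close>)
  have min: "m (D n) \<in> D n \<and> (\<forall>b\<in>D n. (m (D n), b) \<in> r)" for n
    using m[of "D n"] D[of n] assms(2) by fastforce
  have Suc: "D (Suc n) = D n - {m (D n)}" for n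
    by (simp add: D_def)
  have "(m (D n), m (D (Suc n))) \<in> r - Id" for n
    using min[of n] min[of "Suc n"] Suc[of n] by auto
  moreover have "range (\<lambda>n. m (D n)) \<subseteq> T"
    using min D by blast
  ultimately show ?thesis by blast
qed

text \<open>The canonical branch of \<open>i\<close> in the Erdos--Rado tree: a point \<open>j\<close> below \<open>i\<close> is admitted iff
  all earlier admitted points have the same colour with \<open>j\<close> as with \<open>i\<close>. The isomorphism type of
  the coloured branch determines \<open>i\<close>.\<close>

definition end_homogeneous :: "'i rel \<Rightarrow> ('i \<Rightarrow> 'i \<Rightarrow> 'c) \<Rightarrow> 'i \<Rightarrow> 'i set" where
  "end_homogeneous r col i = {j. wfrec (r - Id)
    (\<lambda>Q j. (j, i) \<in> r - Id \<and> (\<forall>k. (k, j) \<in> r - Id \<and> Q k \<longrightarrow> col k j = col k i)) j}"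

text \<open>The recursion consults \<open>Q\<close> only at predecessors of \<open>j\<close>, so one
  unfolding of \<open>wfrec\<close> removes the cut. Later arguments use this equation in place of
  the definition.\<close>

lemma mem_end_homogeneous_iff:
  assumes "wf (r - Id)"
  shows "j \<in> end_homogeneous r col i \<longleftrightarrow> (j, i) \<in> r - Id \<and>
    (\<forall>k \<in> end_homogeneous r col i. (k, j) \<in> r - Id \<longrightarrow> col k j = col k i)"
proof -
  show ?thesis
    unfolding end_homogeneous_def mem_Collect_eq
    by (subst wfrec[OF assms]) (auto simp: cut_apply)
qed

text \<open>The labels \<open>h\<close> and \<open>g\<close> carry both branches into a common set,
  and the two sides of \<open>code\<close> are the labelled orders together with the colours towards
  \<open>i\<close> and \<open>j\<close>. Well-founded induction shows that points with equal labels
  coincide, so the branch with its colours can be read off the code. The reverse inclusion comes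
  from swapping \<open>i\<close> and \<open>j\<close>.\<close>

lemma end_homogeneous_determined:
  fixes h g :: "'i \<Rightarrow> 'k"
  assumes r: "Well_order r"
    and h: "inj_on h (end_homogeneous r col i)" and g: "inj_on g (end_homogeneous r col j)"
    and code: "{(h s, h t, col s i) | s t. s \<in> end_homogeneous r col i \<and>
        t \<in> end_homogeneous r col i \<and> (s, t) \<in> r} =
      {(g s, g t, col s j) | s t. s \<in> end_homogeneous r col j \<and>
        t \<in> end_homogeneous r col j \<and> (s, t) \<in> r}"
  shows "end_homogeneous r col i \<subseteq> end_homogeneous r col j \<and>
    (\<forall>s \<in> end_homogeneous r col i. col s i = col s j)"
proof -
  let ?Si = "end_homogeneous r col i" and ?Sj = "end_homogeneous r col j"
  have wf: "wf (r - Id)" and tr: "trans r" and an: "antisym r" and tot: "total_on (Field r) r"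
    and refl: "refl_on (Field r) r"
    using r by (auto simp: well_order_on_def linear_order_on_def partial_order_on_def
        preorder_on_def)
  have less_trans: "(a, c) \<in> r - Id" if "(a, b) \<in> r - Id" "(b, c) \<in> r - Id" for a b c
    using that tr an by (auto dest: transD antisymD)
  have Si: "s \<in> ?Si \<longleftrightarrow> (s, i) \<in> r - Id \<and> (\<forall>k\<in>?Si. (k, s) \<in> r - Id \<longrightarrow> col k s = col k i)" for s
    by (rule mem_end_homogeneous_iff[OF wf])
  have Sj: "s \<in> ?Sj \<longleftrightarrow> (s, j) \<in> r - Id \<and> (\<forall>k\<in>?Sj. (k, s) \<in> r - Id \<longrightarrow> col k s = col k j)" for s
    by (rule mem_end_homogeneous_iff[OF wf])
  have Fi: "(s, s) \<in> r" if "s \<in> ?Si" for s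
    using that Si[of s] refl_onD[OF refl, of s] by (auto intro: FieldI1)
  have Fj: "(s, s) \<in> r" if "s \<in> ?Sj" for s
    using that Sj[of s] refl_onD[OF refl, of s] by (auto intro: FieldI1)
  have fwd: "\<exists>s'\<in>?Sj. \<exists>t'\<in>?Sj. g s' = h s \<and> g t' = h t \<and> (s', t') \<in> r \<and> col s' j = col s i"
    if "s \<in> ?Si" "t \<in> ?Si" "(s, t) \<in> r" for s t
  proof -
    have "(h s, h t, col s i) \<in> {(g s, g t, col s j) | s t. s \<in> ?Sj \<and> t \<in> ?Sj \<and> (s, t) \<in> r}"
      unfolding code[symmetric] using that by blast
    then show ?thesis by force
  qed
  have bwd: "\<exists>s\<in>?Si. \<exists>t\<in>?Si. h s = g s' \<and> h t = g t' \<and> (s, t) \<in> r \<and> col s i = col s' j"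
    if "s' \<in> ?Sj" "t' \<in> ?Sj" "(s', t') \<in> r" for s' t'
  proof -
    have "(g s', g t', col s' j) \<in> {(h s, h t, col s i) | s t. s \<in> ?Si \<and> t \<in> ?Si \<and> (s, t) \<in> r}"
      unfolding code using that by blast
    then show ?thesis by force
  qed
  \<comment> \<open>Strict order passes between the branches because the labels are injective on
    each of them.\<close>
  have fwd1: "\<exists>k'\<in>?Sj. g k' = h k \<and> col k' j = col k i \<and> (k', s') \<in> r - Id"
    if ks: "k \<in> ?Si" "s \<in> ?Si" "s' \<in> ?Sj" "h s = g s'" "(k, s) \<in> r - Id" for k s s'
  proof -
    obtain k' t' where "k' \<in> ?Sj" "t' \<in> ?Sj" "g k' = h k" "g t' = h s" "(k', t') \<in> r"
      "col k' j = col k i"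
      using fwd[of k s] ks by blast
    moreover have "t' = s'" using calculation ks g by (metis inj_onD)
    moreover have "k' \<noteq> s'" using calculation ks h by (metis DiffD2 IdI inj_onD)
    ultimately show ?thesis by auto
  qed
  have bwd1: "\<exists>k\<in>?Si. h k = g k' \<and> col k i = col k' j \<and> (k, s) \<in> r - Id"
    if ks: "k' \<in> ?Sj" "s \<in> ?Si" "s' \<in> ?Sj" "h s = g s'" "(k', s') \<in> r - Id" for k' s s'
  proof -
    obtain k t where "k \<in> ?Si" "t \<in> ?Si" "h k = g k'" "h t = g s'" "(k, t) \<in> r"
      "col k i = col k' j"
      using bwd[of k' s'] ks by blast
    moreover have "t = s" using calculation ks h by (metis inj_onD)
    moreover have "k \<noteq> s" using calculation ks g by (metis DiffD2 IdI inj_onD)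
    ultimately show ?thesis by auto
  qed
  have same: "s \<in> ?Si \<longrightarrow> (\<forall>s'\<in>?Sj. h s = g s' \<longrightarrow> s = s')" for s
  proof (rule wf_induct[OF wf], intro impI ballI)
    fix s s'
    assume IH: "\<forall>t. (t, s) \<in> r - Id \<longrightarrow> t \<in> ?Si \<longrightarrow> (\<forall>t'\<in>?Sj. h t = g t' \<longrightarrow> t = t')"
      and s: "s \<in> ?Si" "s' \<in> ?Sj" "h s = g s'"
    show "s = s'"
    proof (rule ccontr)
      assume "s \<noteq> s'"
      moreover have "s \<in> Field r" "s' \<in> Field r"
        using Fi[OF s(1)] Fj[OF s(2)] by (auto simp: Field_def)
      ultimately consider "(s, s') \<in> r - Id" | "(s', s) \<in> r - Id"
        using tot by (auto simp: total_on_def)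
      then show False
      proof cases
        case 1
        have "s \<in> ?Sj"
          unfolding Sj[of s]
        proof (intro conjI ballI impI)
          show "(s, j) \<in> r - Id" using 1 s(2) Sj[of s'] less_trans by blast
          fix k assume k: "k \<in> ?Sj" "(k, s) \<in> r - Id"
          then obtain k0 where "k0 \<in> ?Si" "h k0 = g k" "col k0 i = col k j" "(k0, s) \<in> r - Id"
            using bwd1[OF k(1) s] less_trans 1 by blast
          with IH k have "k0 = k" by blast
          then show "col k s = col k j"
            using \<open>k0 \<in> ?Si\<close> \<open>col k0 i = col k j\<close> k(2) s(1) Si[of s] by metis
        qed
        then obtain s0 where "s0 \<in> ?Si" "h s0 = g s" "(s0, s) \<in> r - Id"
          using bwd1[OF _ s 1] by blast
        with IH \<open>s \<in> ?Sj\<close> show False by blast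
      next
        case 2
        have "s' \<in> ?Si"
          unfolding Si[of s']
        proof (intro conjI ballI impI)
          show "(s', i) \<in> r - Id" using 2 s(1) Si[of s] less_trans by blast
          fix k assume k: "k \<in> ?Si" "(k, s') \<in> r - Id"
          then have ks: "(k, s) \<in> r - Id" using less_trans 2 by blast
          then obtain k' where "k' \<in> ?Sj" "g k' = h k" "col k' j = col k i" "(k', s') \<in> r - Id"
            using fwd1[OF k(1) s] by blast
          moreover from this IH k ks have "k = k'" by (metis (no_types))
          ultimately show "col k s' = col k i"
            using k(2) s(2) Sj[of s'] by metis
        qed
        then obtain s'' where "s'' \<in> ?Sj" "g s'' = h s'" "(s'', s') \<in> r - Id"
          using fwd1[OF _ s 2] by blast
        with IH \<open>s' \<in> ?Si\<close> 2 show False by (metis DiffD2 IdI)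
      qed
    qed
  qed
  show ?thesis
  proof (intro conjI subsetI ballI)
    fix s assume s: "s \<in> ?Si"
    then obtain s' where s': "s' \<in> ?Sj" "g s' = h s" "col s' j = col s i"
      using fwd[OF s s Fi[OF s]] by blast
    with same s have "s = s'" by metis
    with s' show "s \<in> ?Sj" "col s i = col s j" by auto
  qed
qed

lemma card_of_Pow_mono:
  assumes "|A| \<le>o |B|"
  shows "|Pow A| \<le>o |Pow B|"
proof -
  obtain u where "inj_on u A" "u ` A \<subseteq> B"
    using assms by (auto simp: card_of_ordLeq[symmetric])
  then show ?thesis
    using card_of_ordLeq inj_on_image_Pow image_Pow_mono by metis
qed

text \<open>If every branch had at most \<open>|K|\<close> points, its code would be a subset of
  \<open>K \<times> K \<times> K\<close>, and there are too few of these to tell all points of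
  \<open>Field r\<close> apart. So some branch has more than \<open>|K|\<close> points, and the
  pigeonhole principle applies to the colours towards its top \<open>i\<close>.\<close>

lemma homogeneous_ascending_sequence:
  fixes r :: "'i rel" and K :: "'k set"
  assumes r: "Well_order r" and big: "\<not> |Field r| \<le>o |Pow K|" and K: "infinite K"
    and col: "\<And>i j. (i, j) \<in> r - Id \<Longrightarrow> col i j \<in> K"
  shows "\<exists>s c. \<forall>n::nat. (s n, s (Suc n)) \<in> r - Id \<and> col (s n) (s (Suc n)) = c"
proof -
  let ?S = "end_homogeneous r col"
  have wf: "wf (r - Id)" and tot: "total_on (Field r) r"
    using r by (auto simp: well_order_on_def linear_order_on_def)
  have S: "s \<in> ?S i \<longleftrightarrow> (s, i) \<in> r - Id \<and> (\<forall>k\<in>?S i. (k, s) \<in> r - Id \<longrightarrow> col k s = col k i)" for s i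
    by (rule mem_end_homogeneous_iff[OF wf])
  have "\<exists>i. \<not> |?S i| \<le>o |K|"
  proof (rule ccontr)
    assume "\<nexists>i. \<not> |?S i| \<le>o |K|"
    then have "\<forall>i. \<exists>h. inj_on h (?S i) \<and> h ` ?S i \<subseteq> K"
      by (simp add: card_of_ordLeq)
    then obtain h where h: "\<And>i. inj_on (h i) (?S i)" "\<And>i. h i ` ?S i \<subseteq> K"
      by metis
    define code where
      "code i = {(h i s, h i t, col s i) | s t. s \<in> ?S i \<and> t \<in> ?S i \<and> (s, t) \<in> r}" for i
    have less: "\<not> (i, j) \<in> r - Id" if "code i = code j" for i j
    proof
      assume ij: "(i, j) \<in> r - Id"
      have le: "?S i \<subseteq> ?S j" "\<forall>s\<in>?S i. col s i = col s j" and ge: "?S j \<subseteq> ?S i"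
        using end_homogeneous_determined[OF r h(1)[of i] h(1)[of j]]
          end_homogeneous_determined[OF r h(1)[of j] h(1)[of i]] that
        unfolding code_def by blast+
      then have "i \<in> ?S j" using ij S[of i j] by blast
      then show False using ge S[of i i] by blast
    qed
    have "inj_on code (Field r)"
    proof (rule inj_onI, rule ccontr)
      fix i j assume "i \<in> Field r" "j \<in> Field r" "code i = code j" "i \<noteq> j"
      then show False using tot less[of i j] less[of j i] by (auto simp: total_on_def)
    qed
    moreover have "code ` Field r \<subseteq> Pow (K \<times> K \<times> K)"
      using h(2) col S unfolding code_def by blast
    ultimately have "|Field r| \<le>o |Pow (K \<times> K \<times> K)|"
      using card_of_ordLeq by blast
    also have "|Pow (K \<times> K \<times> K)| \<le>o |Pow K|"
    proof -
      have KK: "|K \<times> K| =o |K|" using K by (rule card_of_Times_same_infinite)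
      have "|K \<times> K \<times> K| =o |K \<times> K|"
        using KK ordIso_iff_ordLeq card_of_Times_mono2 by metis
      then have "|K \<times> K \<times> K| \<le>o |K|" using KK ordIso_transitive ordIso_iff_ordLeq by blast
      then show ?thesis by (rule card_of_Pow_mono)
    qed
    finally (ordLeq_transitive) show False using big by blast
  qed
  then obtain i where i: "\<not> |?S i| \<le>o |K|" by blast
  \<comment> \<open>Otherwise the branch would be a union of \<open>|K|\<close> many finite classes,
    hence of size at most \<open>|K|\<close>.\<close>
  have "\<exists>c\<in>K. infinite {s\<in>?S i. col s i = c}"
  proof (rule ccontr)
    assume "\<not> ?thesis"
    then have "{s\<in>?S i. col s i = c} \<lesssim> K" if "c \<in> K" for c
      using finite_lepoll_infinite[OF K] that by blast
    then have "\<forall>c\<in>K. |{s\<in>?S i. col s i = c}| \<le>o |K|"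
      unfolding lepoll_def card_of_ordLeq[symmetric] by blast
    then have "|\<Union>c\<in>K. {s\<in>?S i. col s i = c}| \<le>o |K|"
      using K by (intro card_of_UNION_ordLeq_infinite) (auto intro: card_of_mono1)
    moreover have "(\<Union>c\<in>K. {s\<in>?S i. col s i = c}) = ?S i"
      using S col by blast
    ultimately show False using i by simp
  qed
  then obtain c where c: "infinite {s\<in>?S i. col s i = c}" by blast
  moreover have "{s\<in>?S i. col s i = c} \<subseteq> Field r"
    using S by (blast intro: FieldI1)
  ultimately obtain s :: "nat \<Rightarrow> 'i" where s: "range s \<subseteq> {s\<in>?S i. col s i = c}"
    "\<And>n. (s n, s (Suc n)) \<in> r - Id"
    using ascending_sequence_in_infinite_set[OF r] by blast
  have "s n \<in> ?S i \<and> col (s n) i = c" for n using s(1) by blast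
  \<comment> \<open>On the branch, the colour of a pair is the colour of its lower point with
    \<open>i\<close>.\<close>
  then have "col (s n) (s (Suc n)) = c" for n
    using s(2)[of n] S[of "s (Suc n)" i] by metis
  with s(2) show ?thesis by blast
qed

text \<open>Ensures that finite words of colours are no more numerous than an infinite bound on the
  colours: each length contributes at most \<open>|B|\<close> words, and there are countably many
  lengths.\<close>

lemma card_of_lists_le:
  fixes A :: "'a set"
  assumes "infinite B" "|A| \<le>o |B|"
  shows "|lists A| \<le>o |B|"
proof -
  have "|{xs \<in> lists A. length xs = n}| \<le>o |B|" for n
  proof (induction n)
    case 0
    have "{xs \<in> lists A. length xs = 0} = {[]}" by auto
    then show ?case using assms(1)
      by (metis card_of_ordLeq_infinite card_of_Well_order finite.emptyI finite.insertI ordLeq_total)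
  next
    case (Suc n)
    have "{xs \<in> lists A. length xs = Suc n} \<subseteq>
      (\<lambda>(x, xs). x # xs) ` (A \<times> {xs \<in> lists A. length xs = n})"
      by (auto simp: length_Suc_conv image_iff)
    then have "|{xs \<in> lists A. length xs = Suc n}| \<le>o |A \<times> {xs \<in> lists A. length xs = n}|"
      by (meson card_of_image card_of_mono1 ordLeq_transitive)
    also have "|A \<times> {xs \<in> lists A. length xs = n}| \<le>o |B \<times> B|"
      using card_of_Times_mono1[OF assms(2)] card_of_Times_mono2[OF Suc] ordLeq_transitive by blast
    also have "|B \<times> B| =o |B|" using assms(1) by (rule card_of_Times_same_infinite)
    finally (ordLeq_ordIso_trans) show ?case .
  qed
  then have "|\<Union>n\<in>UNIV. {xs \<in> lists A. length xs = n}| \<le>o |B|"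
    using assms(1) by (intro card_of_UNION_ordLeq_infinite) (auto simp: infinite_iff_card_of_nat)
  moreover have "(\<Union>n\<in>UNIV. {xs \<in> lists A. length xs = n}) = lists A" by auto
  ultimately show ?thesis by simp
qed

section \<open>Neighbourhood colourings\<close>

text \<open>\<open>N\<close> is the class of all neighbourhoods of one colour.\<close>

definition coherent_nbhds :: "'b topology \<Rightarrow> 'b \<Rightarrow> ('b set \<Rightarrow> bool) \<Rightarrow> bool" where
  "coherent_nbhds X x N \<longleftrightarrow>
    (\<forall>W :: nat \<Rightarrow> 'b set. (\<forall>n. N (W n)) \<longrightarrow> (\<exists>V. openin X V \<and> x \<in> V \<and> (\<forall>n. V \<subseteq> W n)))"

lemma coherent_nbhdsD:
  assumes "coherent_nbhds X x N" "\<And>n::nat. N (W n)"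
  obtains V where "openin X V" "x \<in> V" "\<And>n. V \<subseteq> W n"
  using assms unfolding coherent_nbhds_def by blast

section \<open>Descent along diamonds\<close>

lemma no_descent_through_derived_sets:
  fixes X :: "'b :: wellorder topology" and A :: "nat \<Rightarrow> 'b set"
  assumes lower: "\<And>y. y \<in> topspace X \<Longrightarrow> \<exists>W. openin X W \<and> y \<in> W \<and> W \<subseteq> {..y}"
    and V: "openin X V" "x \<in> V"
    and step: "\<And>n. V \<inter> A n - {x} \<subseteq> X derived_set_of A (Suc n)"
  shows "x \<notin> X derived_set_of A 0"
proof
  assume x: "x \<in> X derived_set_of A 0"
  have V_sub: "V \<subseteq> topspace X" using V(1) by (rule openin_subset)
  have descend: "\<exists>z. z \<noteq> y \<and> z \<in> A n \<and> z \<in> V \<and> z \<le> y" 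
    if y: "y \<in> X derived_set_of A n" "y \<in> V" for y n
  proof -
    obtain W where W: "openin X W" "y \<in> W" "W \<subseteq> {..y}" using lower[of y] y(2) V_sub by auto
    then have VW: "openin X (V \<inter> W)" "y \<in> V \<inter> W" using V(1) y(2) by auto
    then obtain z where "z \<noteq> y" "z \<in> A n" "z \<in> V \<inter> W"
      using y(1) unfolding in_derived_set_of by blast
    then show ?thesis using W(3) by auto
  qed
  \<comment> \<open>The index is arbitrary in the induction because it grows while \<open>y\<close>
    descends. Staying strictly below \<open>x\<close> avoids the one point of \<open>V\<close> that
    \<open>step\<close> exempts.\<close>
  have "\<not> (y < x \<and> y \<in> V \<and> y \<in> A n)" for y n
  proof (induction y arbitrary: n rule: less_induct)
    case (less y)
    show ?case
    proof
      assume y: "y < x \<and> y \<in> V \<and> y \<in> A n"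
      then have "y \<in> X derived_set_of A (Suc n)" using step[of n] by auto
      then obtain z where "z \<noteq> y" "z \<in> A (Suc n)" "z \<in> V" "z \<le> y" using descend y by blast
      with y less[of z "Suc n"] show False by (metis le_less le_less_trans)
    qed
  qed
  moreover obtain z where "z \<noteq> x" "z \<in> A 0" "z \<in> V" "z \<le> x" using descend[OF x V(2)] by blast
  ultimately show False by (metis order.not_eq_order_implies_strict)
qed

text \<open>With derived sets in place of closures, a box at \<open>x\<close> speaks only of a
  punctured neighbourhood; hence the removal of \<open>x\<close>.\<close>

lemma truth_set_Box_Imp_Dia:
  assumes V: "\<And>q. V q \<subseteq> topspace X"
    and x: "x \<in> truth_set X V (Box (Imp (Var q) (Dia (Var q'))))"
  shows "\<exists>U. openin X U \<and> x \<in> U \<and> U \<inter> V q - {x} \<subseteq> X derived_set_of V q'"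
proof -
  let ?I = "truth_set X V (Imp (Var q) (Dia (Var q')))"
  have "x \<in> topspace X" "x \<notin> X derived_set_of (topspace X - ?I)"
    using x by auto
  then obtain U where U: "openin X U" "x \<in> U" "\<And>y. y \<in> U \<Longrightarrow> y \<noteq> x \<Longrightarrow> y \<notin> topspace X - ?I"
    unfolding in_derived_set_of by blast
  have "?I = topspace X - (V q \<inter> (topspace X - X derived_set_of V q'))"
    using truth_set_Dia[of V X "Var q'", OF V] by (simp add: Imp_def)
  then have "U \<inter> V q - {x} \<subseteq> X derived_set_of V q'"
    using U(3) V by blast
  then show ?thesis using U by blast
qed

section \<open>From subbasic sets to all neighbourhoods\<close>

text \<open>A neighbourhood contains a finite intersection of subbasic sets around \<open>x\<close>;
  the word of their colours serves as its colour. Intersections of open sets concatenate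
  words.\<close>

lemma generated_neighbourhood_colouring:
  assumes "generate_topology_on S U" "x \<in> U"
    and cover: "\<And>W. W \<in> S \<Longrightarrow> x \<in> W \<Longrightarrow> \<exists>c\<in>K. N c W"
  shows "\<exists>cs\<in>lists K. \<exists>Ws. list_all2 N cs Ws \<and> \<Inter> (set Ws) \<subseteq> U"
  using assms(1,2)
proof (induction U rule: generate_topology_on.induct)
  case (Int a b)
  then obtain cs Ws cs' Ws' where "cs \<in> lists K" "list_all2 N cs Ws" "\<Inter> (set Ws) \<subseteq> a"
    "cs' \<in> lists K" "list_all2 N cs' Ws'" "\<Inter> (set Ws') \<subseteq> b" by blast
  then show ?case
    by (intro bexI[of _ "cs @ cs'"] exI[of _ "Ws @ Ws'"]) (auto intro: list_all2_appendI)
next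
  case (UN F)
  then obtain k where "k \<in> F" "x \<in> k" by blast
  with UN.IH[of k] show ?case by blast
next
  case (Basis W)
  then obtain c where "c \<in> K" "N c W" using cover by blast
  then show ?case
    by (intro bexI[of _ "[c]"] exI[of _ "[W]"]) auto
qed simp

text \<open>The word fixes the number of factors and the colour of each. In every position the
  countably many factors have a common neighbourhood, and these finitely many neighbourhoods are
  intersected.\<close>

lemma coherent_nbhds_Inter:
  assumes coherent: "\<And>c. c \<in> K \<Longrightarrow> coherent_nbhds X x (N c)" and x: "x \<in> topspace X"
    and cs: "cs \<in> lists K"
  shows "coherent_nbhds X x (\<lambda>U. \<exists>Ws. list_all2 N cs Ws \<and> \<Inter> (set Ws) \<subseteq> U)"
  using cs
proof (induction cs)
  case Nil
  show ?case
    unfolding coherent_nbhds_def using x by (auto intro!: exI[of _ "topspace X"])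
next
  case (Cons c cs)
  show ?case
    unfolding coherent_nbhds_def
  proof (intro allI impI)
    fix U assume "\<forall>n::nat. \<exists>Ws. list_all2 N (c # cs) Ws \<and> \<Inter> (set Ws) \<subseteq> U n"
    then have "\<forall>n. \<exists>W Ws. N c W \<and> list_all2 N cs Ws \<and> W \<inter> \<Inter> (set Ws) \<subseteq> U n"
      by (auto simp: list_all2_Cons1) (metis Inter_insert list.simps(15))
    then obtain W Ws where W: "\<And>n. N c (W n)" and Ws: "\<And>n. list_all2 N cs (Ws n)"
      and sub: "\<And>n. W n \<inter> \<Inter> (set (Ws n)) \<subseteq> U n"
      by metis
    obtain V1 where V1: "openin X V1" "x \<in> V1" "\<And>n. V1 \<subseteq> W n"
      using coherent_nbhdsD[OF coherent, of c W] W Cons.hyps by blast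
    obtain V2 where V2: "openin X V2" "x \<in> V2" "\<And>n. V2 \<subseteq> \<Inter> (set (Ws n))"
      using coherent_nbhdsD[OF Cons.IH, of "\<lambda>n. \<Inter> (set (Ws n))"] Ws by blast
    show "\<exists>V. openin X V \<and> x \<in> V \<and> (\<forall>n. V \<subseteq> U n)"
    proof (intro exI[of _ "V1 \<inter> V2"] conjI allI)
      show "V1 \<inter> V2 \<subseteq> U n" for n using V1(3)[of n] V2(3)[of n] sub[of n] by blast
    qed (use V1 V2 in auto)
  qed
qed

text \<open>A constant sequence is cofinal below a point with an immediate predecessor, so such
  points count as having countable cofinality.\<close>

definition cofinal_sequence :: "'b :: linorder \<Rightarrow> (nat \<Rightarrow> 'b) \<Rightarrow> bool" where
  "cofinal_sequence v a \<longleftrightarrow> (\<forall>n. a n < v) \<and> (\<forall>b<v. \<exists>n. b \<le> a n)"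

lemma bounded_below_uncountable_cofinality:
  assumes "\<nexists>a. cofinal_sequence v a" "\<And>n::nat. b n < v"
  shows "\<exists>c<v. \<forall>n. b n \<le> c"
proof -
  have "\<not> cofinal_sequence v b" using assms(1) by blast
  then obtain c where "c < v" "\<And>n. \<not> c \<le> b n"
    using assms(2) unfolding cofinal_sequence_def by blast
  then show ?thesis by (auto simp: not_le less_imp_le)
qed

lemma not_satisfiable_Gamma:
  fixes X :: "'b :: wellorder topology" and r :: "'i rel" and K :: "'k set"
  assumes r: "Well_order r" "\<not> |Field r| \<le>o |Pow K|" and K: "infinite K"
    and lower: "\<And>y. y \<in> topspace X \<Longrightarrow> \<exists>W. openin X W \<and> y \<in> W \<and> W \<subseteq> {..y}"
    and coherent: "\<And>x c. x \<in> topspace X \<Longrightarrow> c \<in> K \<Longrightarrow> coherent_nbhds X x (N x c)"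
    and cover: "\<And>x U. openin X U \<Longrightarrow> x \<in> U \<Longrightarrow> \<exists>c\<in>K. N x c U"
  shows "\<not> satisfiable X (Gamma_fms r p)"
proof
  assume "satisfiable X (Gamma_fms r p)"
  then obtain V x where V: "\<And>q. V q \<subseteq> topspace X" and x: "x \<in> topspace X"
    and sat: "\<And>\<phi>. \<phi> \<in> Gamma_fms r p \<Longrightarrow> x \<in> truth_set X V \<phi>"
    unfolding satisfiable_def by blast
  have dia: "x \<in> X derived_set_of V (p i)" if "i \<in> Field r" for i
  proof -
    have "Dia (Var (p i)) \<in> Gamma_fms r p" using that unfolding Gamma_fms_def by blast
    then show ?thesis using sat truth_set_Dia[of V X "Var (p i)", OF V] by auto
  qed
  have "\<exists>U. openin X U \<and> x \<in> U \<and> U \<inter> V (p i) - {x} \<subseteq> X derived_set_of V (p j)"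
    if ij: "(i, j) \<in> r - Id" for i j
  proof (rule truth_set_Box_Imp_Dia[of V X x "p i" "p j", OF V])
    have "Box (Imp (Var (p i)) (Dia (Var (p j)))) \<in> Gamma_fms r p"
      using ij unfolding Gamma_fms_def by blast
    then show "x \<in> truth_set X V (Box (Imp (Var (p i)) (Dia (Var (p j)))))" by (rule sat)
  qed
  then obtain U where U: "\<And>i j. (i, j) \<in> r - Id \<Longrightarrow> openin X (U i j) \<and> x \<in> U i j \<and>
      U i j \<inter> V (p i) - {x} \<subseteq> X derived_set_of V (p j)"
    by metis
  \<comment> \<open>A neighbourhood may have several colours; any one of them is chosen.\<close>
  define col where "col i j = (SOME c. c \<in> K \<and> N x c (U i j))" for i j
  have col: "col i j \<in> K \<and> N x (col i j) (U i j)" if "(i, j) \<in> r - Id" for i j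
    unfolding col_def by (rule someI_ex) (use cover[of "U i j" x] U[OF that] in blast)
  obtain s :: "nat \<Rightarrow> 'i" and c where s: "\<And>n. (s n, s (Suc n)) \<in> r - Id"
      "\<And>n. col (s n) (s (Suc n)) = c"
    using homogeneous_ascending_sequence[OF r K, of col] conjunct1[OF col] by metis
  have "c \<in> K" "\<And>n. N x c (U (s n) (s (Suc n)))"
    using col[OF s(1)] s(2) by metis+
  then obtain Q where Q: "openin X Q" "x \<in> Q" "\<And>n. Q \<subseteq> U (s n) (s (Suc n))"
    using coherent_nbhdsD[OF coherent[OF x, of c], of "\<lambda>n. U (s n) (s (Suc n))"] by blast
  have "x \<notin> X derived_set_of V (p (s 0))"
  proof (rule no_descent_through_derived_sets[OF lower Q(1,2), where A = "\<lambda>n. V (p (s n))"])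
    show "Q \<inter> V (p (s n)) - {x} \<subseteq> X derived_set_of V (p (s (Suc n)))" for n
      using Q(3)[of n] U[OF s(1)[of n]] by blast
  qed
  moreover have "s 0 \<in> Field r" using s(1)[of 0] by (auto intro: FieldI1)
  ultimately show False using dia by blast
qed

text \<open>Characteristic functions identify \<open>ctwo ^c |M|\<close> with
  \<open>|Pow M|\<close>, which brings the successor cardinal into the form used in the partition
  argument.\<close>

lemma card_of_Pow_lt_cardSuc:
  assumes "r =o cardSuc (ctwo ^c |M| )" "|K| \<le>o |M|"
  shows "Well_order r \<and> \<not> |Field r| \<le>o |Pow K|"
proof -
  have C: "Card_order (ctwo ^c |M| )" by (rule Card_order_cexp)
  then have "Card_order (cardSuc (ctwo ^c |M| ))" by (rule cardSuc_Card_order)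
  then have r: "Card_order r" using assms(1) Card_order_ordIso by blast
  have Pow: "|Pow M| =o ctwo ^c |M|"
    using card_of_Pow_Func[of M] by (simp add: cexp_def ctwo_def Field_card_of)
  have "\<not> |Field r| \<le>o |Pow K|"
  proof
    assume "|Field r| \<le>o |Pow K|"
    then have "r \<le>o |Pow K|"
      using card_of_Field_ordIso[OF r] ordIso_symmetric ordIso_ordLeq_trans by blast
    also have "|Pow K| \<le>o |Pow M|" using assms(2) by (rule card_of_Pow_mono)
    also (ordLeq_transitive) note Pow
    finally (ordLeq_ordIso_trans) have "cardSuc (ctwo ^c |M| ) \<le>o ctwo ^c |M|"
      using assms(1) ordIso_symmetric ordIso_ordLeq_trans by blast
    then show False
      using cardSuc_greater[OF C] not_ordLess_ordLeq by blast
  qed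
  then show ?thesis using r by (auto simp: card_order_on_def)
qed

text \<open>Covers both spaces at once: the base topology \<open>B\<close> is the left or the club
  topology, and \<open>rk\<close> the identity or the rank.\<close>

lemma not_satisfiable_Gamma_with_hyperlog_intervals:
  fixes lam \<Theta> :: "'a ordinal"
  assumes r: "r =o cardSuc (ctwo ^c ( |{..<lam}| +c natLeq))"
    and top: "topspace B = {..<\<Theta>}"
    and lower: "\<And>y. y < \<Theta> \<Longrightarrow> openin B {..y}"
    and coherent: "\<And>x. x < \<Theta> \<Longrightarrow> coherent_nbhds B x (\<lambda>W. openin B W \<and> x \<in> W)"
  shows "\<not> satisfiable
    (topology_generated_by (Collect (openin B) \<union> hyperlog_intervals lam \<Theta> rk)) (Gamma_fms r p)"
proof -
  define S where "S = Collect (openin B) \<union> hyperlog_intervals lam \<Theta> rk"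
  define X where "X = topology_generated_by S"
  define I where "I \<alpha> \<beta> \<xi> = {t. t < \<Theta> \<and> \<alpha> < Some (hyperlog \<xi> (rk t)) \<and> hyperlog \<xi> (rk t) \<le> \<beta>}"
    for \<alpha> :: "'a ordinal option" and \<beta> \<xi> :: "'a ordinal"
  have intervals: "hyperlog_intervals lam \<Theta> rk =
      {I \<alpha> \<beta> \<xi> | \<alpha> \<beta> \<xi>. \<alpha> < Some \<beta> \<and> \<beta> \<le> \<Theta> \<and> \<xi> < lam}"
    unfolding hyperlog_intervals_def I_def ..
  have top_X: "topspace X = {..<\<Theta>}"
    using openin_subset[of B] top openin_topspace[of B]
    by (auto simp: X_def S_def intervals I_def)
  have open_S: "openin X W" if "W \<in> S" for W
    using that unfolding X_def by (rule topology_generated_by_Basis)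
  \<comment> \<open>By the definition of \<open>+c\<close>, \<open>|M|\<close> is the exponent in
    the assumption on \<open>r\<close>. The set \<open>K\<close> of colours has one colour for open
    sets of \<open>B\<close> and one for each pair of a coordinate and a position in a
    sequence.\<close>
  define M where "M = {..<lam} <+> (UNIV :: nat set)"
  define K where "K = insert None (Some ` ({..<lam} \<times> (UNIV :: nat set)))"
  \<comment> \<open>The colour of an interval records its index and, if its centre has countable cofinality, how far
    along a fixed cofinal sequence the lower bound lies.\<close>
  define N where "N x c W \<longleftrightarrow> x \<in> W \<and> (case c of None \<Rightarrow> openin B W | Some (\<xi>, n) \<Rightarrow>
      \<xi> < lam \<and> (\<exists>\<alpha> \<beta>. W = I \<alpha> \<beta> \<xi> \<and> \<beta> \<le> \<Theta> \<and>
        (let v = Some (hyperlog \<xi> (rk x)) in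
          (\<exists>a. cofinal_sequence v a) \<longrightarrow> \<alpha> \<le> (SOME a. cofinal_sequence v a) n)))" for x c W
  have M: "infinite M" by (auto simp: M_def)
  have "|K| \<le>o |M|"
  proof -
    have "|{..<lam}| \<le>o |M|" "|UNIV :: nat set| \<le>o |M|"
      unfolding M_def by (rule card_of_Plus1 card_of_Plus2)+
    then have "|{..<lam} \<times> (UNIV :: nat set)| \<le>o |M|"
      using M by (intro card_of_Sigma_ordLeq_infinite) auto
    then have "|Some ` ({..<lam} \<times> (UNIV :: nat set))| \<le>o |M|"
      using card_of_image ordLeq_transitive by blast
    moreover have "|{None :: ('a ordinal \<times> nat) option}| \<le>o |M|"
      using M finite_lepoll_infinite[of M "{None :: ('a ordinal \<times> nat) option}"]
      unfolding lepoll_def card_of_ordLeq by simp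
    ultimately show ?thesis
      unfolding K_def
      using M card_of_Un_ordLeq_infinite_Field[of "|M|" "{None}"]
      by (metis Field_card_of card_of_Card_order insert_is_Un)
  qed
  then have "|lists K| \<le>o |M|" using M by (intro card_of_lists_le)
  moreover have "r =o cardSuc (ctwo ^c |M| )"
    using r by (simp add: csum_def M_def Field_card_of Field_natLeq)
  ultimately have rK: "Well_order r" "\<not> |Field r| \<le>o |Pow (lists K)|"
    using card_of_Pow_lt_cardSuc by blast+
  have cover: "\<exists>c\<in>K. N x c W" if W: "W \<in> S" "x \<in> W" for x W
  proof (cases "openin B W")
    case True
    then show ?thesis using W by (intro bexI[of _ None]) (auto simp: N_def K_def)
  next
    case False
    then obtain \<alpha> \<beta> \<xi> where I: "W = I \<alpha> \<beta> \<xi>" "\<beta> \<le> \<Theta>" "\<xi> < lam"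
      using W by (auto simp: S_def intervals)
    let ?v = "Some (hyperlog \<xi> (rk x))"
    have "\<alpha> < ?v" using W I by (simp add: I_def)
    \<comment> \<open>Without a cofinal sequence the implication is vacuous and any \<open>n\<close>
      will do.\<close>
    then have "\<exists>n. (\<exists>a. cofinal_sequence ?v a) \<longrightarrow> \<alpha> \<le> (SOME a. cofinal_sequence ?v a) n"
      using someI_ex[of "cofinal_sequence ?v"] unfolding cofinal_sequence_def by blast
    then obtain n where "(\<exists>a. cofinal_sequence ?v a) \<longrightarrow> \<alpha> \<le> (SOME a. cofinal_sequence ?v a) n" ..
    then have "N x (Some (\<xi>, n)) W" using W I unfolding N_def Let_def by auto
    then show ?thesis using I by (intro bexI[of _ "Some (\<xi>, n)"]) (auto simp: K_def)
  qed
  have coherent_X: "coherent_nbhds X x (N x c)" if x: "x \<in> topspace X" for x c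
    unfolding coherent_nbhds_def
  proof (intro allI impI)
    fix W :: "nat \<Rightarrow> 'a ordinal set"
    assume W: "\<forall>n. N x c (W n)"
    show "\<exists>V. openin X V \<and> x \<in> V \<and> (\<forall>n. V \<subseteq> W n)"
    proof (cases c)
      case None
      then obtain V where "openin B V" "x \<in> V" "\<forall>n. V \<subseteq> W n"
        using coherent_nbhdsD[OF coherent, of x W] W x top_X unfolding N_def by auto
      then show ?thesis using open_S by (auto simp: S_def)
    next
      case (Some \<xi>n)
      then obtain \<xi> n where c: "c = Some (\<xi>, n)" by (cases \<xi>n) auto
      let ?v = "Some (hyperlog \<xi> (rk x))"
      define a where "a = (SOME a. cofinal_sequence ?v a)"
      have lam: "\<xi> < lam"
        and "\<forall>m. \<exists>\<alpha> \<beta>. W m = I \<alpha> \<beta> \<xi> \<and> \<beta> \<le> \<Theta> \<and> x \<in> W m \<and>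
          ((\<exists>a. cofinal_sequence ?v a) \<longrightarrow> \<alpha> \<le> a n)"
        using W unfolding c N_def Let_def a_def by auto
      then obtain \<alpha> \<beta> where W_eq: "\<And>m. W m = I (\<alpha> m) (\<beta> m) \<xi>" "\<And>m. \<beta> m \<le> \<Theta>" "\<And>m. x \<in> W m"
        and le: "\<And>m. (\<exists>a. cofinal_sequence ?v a) \<Longrightarrow> \<alpha> m \<le> a n"
        by metis
      have v: "\<alpha> m < ?v" "hyperlog \<xi> (rk x) \<le> \<beta> m" for m
        using W_eq(3)[of m] unfolding W_eq(1) I_def by auto
      \<comment> \<open>A common lower bound for the intervals: the term \<open>a n\<close> recorded
        in the colour if a cofinal sequence exists, otherwise a strict bound from uncountable
        cofinality.\<close>
      have "\<exists>\<gamma><?v. \<forall>m. \<alpha> m \<le> \<gamma>"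
      proof (cases "\<exists>a. cofinal_sequence ?v a")
        case True
        then have "cofinal_sequence ?v a" unfolding a_def by (rule someI_ex)
        then show ?thesis using le[OF True] unfolding cofinal_sequence_def by blast
      next
        case False
        then show ?thesis using v(1) by (rule bounded_below_uncountable_cofinality)
      qed
      then obtain \<gamma> where \<gamma>: "\<gamma> < ?v" "\<And>m. \<alpha> m \<le> \<gamma>" by blast
      \<comment> \<open>The upper endpoint is the coordinate of \<open>x\<close> itself. It is below
        every \<open>\<beta> m\<close>, and it is admissible because
        \<open>\<beta> 0 \<le> \<Theta>\<close>.\<close>
      have "I \<gamma> (hyperlog \<xi> (rk x)) \<xi> \<in> S"
        using \<gamma>(1) lam order_trans[OF v(2)[of 0] W_eq(2)[of 0]] unfolding S_def intervals by blast
      moreover have "x \<in> I \<gamma> (hyperlog \<xi> (rk x)) \<xi>"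
        using \<gamma>(1) x top_X by (simp add: I_def)
      moreover have "I \<gamma> (hyperlog \<xi> (rk x)) \<xi> \<subseteq> W m" for m
        using \<gamma>(2)[of m] v(2)[of m] unfolding W_eq(1) I_def by auto
      ultimately show ?thesis using open_S by blast
    qed
  qed
  have "\<not> satisfiable X (Gamma_fms r p)"
  proof (rule not_satisfiable_Gamma[OF rK])
    show "infinite (lists K)"
    proof
      assume "finite (lists K)"
      moreover have "(\<lambda>n. replicate n None) ` UNIV \<subseteq> lists K"
        by (auto simp: K_def)
      moreover have "inj (\<lambda>n. replicate n (None :: ('a ordinal \<times> nat) option))"
        by (rule injI) (metis length_replicate)
      ultimately show False
        using finite_subset finite_imageD infinite_UNIV_nat by metis
    qed
    show "\<exists>W. openin X W \<and> y \<in> W \<and> W \<subseteq> {..y}" if "y \<in> topspace X" for y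
      using that lower[of y] top_X open_S by (intro exI[of _ "{..y}"]) (auto simp: S_def)
    show "coherent_nbhds X x (\<lambda>U. \<exists>Ws. list_all2 (N x) cs Ws \<and> \<Inter> (set Ws) \<subseteq> U)"
      if "x \<in> topspace X" "cs \<in> lists K" for x cs
      using coherent_X[OF that(1)] that by (rule coherent_nbhds_Inter)
    show "\<exists>cs\<in>lists K. \<exists>Ws. list_all2 (N x) cs Ws \<and> \<Inter> (set Ws) \<subseteq> U"
      if "openin X U" "x \<in> U" for x U
      using openin_topology_generated_by[OF that(1)[unfolded X_def]] that(2) cover
      by (rule generated_neighbourhood_colouring)
  qed
  then show ?thesis unfolding X_def S_def .
qed

section \<open>The club topology\<close>

text \<open>For strictly increasing \<open>e\<close> this is the supremum.\<close>

definition strict_sup :: "(nat \<Rightarrow> 'a ordinal) \<Rightarrow> 'a ordinal" where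
  "strict_sup e = (LEAST b. \<forall>n. e n < b)"

lemma less_strict_sup: "e n < strict_sup e"
proof -
  have "|range e| \<le>o |UNIV :: nat set|" by (rule card_of_image)
  also have "|UNIV :: nat set| \<le>o |UNIV :: ('a + nat) set|"
    by (rule card_of_ordLeqI[of Inr]) auto
  finally (ordLeq_transitive) obtain b where "\<And>n. e n \<le> b"
    using small_bounded by blast
  then have "\<forall>n. e n < osuc b" using osuc_greater le_less_trans by blast
  then have "\<forall>n. e n < strict_sup e" unfolding strict_sup_def by (rule LeastI)
  then show ?thesis ..
qed

lemma strict_sup_le: "(\<And>n. e n < b) \<Longrightarrow> strict_sup e \<le> b"
  unfolding strict_sup_def by (rule Least_le) blast

text \<open>Were the supremum \<open>osuc b\<close>, then \<open>e n < e (Suc n) \<le> b\<close> for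
  all \<open>n\<close>, so \<open>b\<close> would already be a strict bound.\<close>

lemma is_limit_strict_sup:
  assumes "\<And>n. e n < e (Suc n)"
  shows "is_limit (strict_sup e)"
proof -
  have "strict_sup e \<noteq> 0"
    using less_strict_sup[of e 0] by (metis leD zero_le_ordinal)
  moreover have "strict_sup e \<noteq> osuc b" for b
  proof
    assume b: "strict_sup e = osuc b"
    have "e n < b" for n
      using assms[of n] less_strict_sup[of e "Suc n"] b osuc_le_iff[of b "e (Suc n)"]
      by (metis le_less_trans leD not_le)
    then have "strict_sup e \<le> b" by (rule strict_sup_le)
    then show False using b osuc_greater[of b] by simp
  qed
  ultimately show ?thesis by (simp add: is_limit_def)
qed

text \<open>As \<open>omega\<close> is a \<open>LEAST\<close>, some limit must be exhibited: the
  supremum of the finite ordinals.\<close>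

lemma is_limit_omega: "is_limit (omega :: 'a ordinal)"
proof -
  have "is_limit (strict_sup (\<lambda>n. (osuc ^^ n) (0 :: 'a ordinal)))"
    by (rule is_limit_strict_sup) (simp add: osuc_greater)
  then show ?thesis unfolding omega_def by (rule LeastI)
qed

lemma finite_iterate_less_omega: "(osuc ^^ n) 0 < (omega :: 'a ordinal)"
proof (induction n)
  case 0
  have "(omega :: 'a ordinal) \<noteq> 0" using is_limit_omega[where 'a = 'a] by (simp add: is_limit_def)
  then show ?case by (simp add: order.not_eq_order_implies_strict)
next
  case (Suc n)
  then have "osuc ((osuc ^^ n) (0 :: 'a ordinal)) \<le> omega" by (simp add: osuc_le_iff)
  moreover have "omega \<noteq> osuc ((osuc ^^ n) (0 :: 'a ordinal))" using is_limit_omega[where 'a = 'a] by (auto simp: is_limit_def)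
  ultimately show ?case by simp
qed

lemma cofinality_le_omega:
  fixes e :: "nat \<Rightarrow> 'a ordinal"
  assumes "\<And>n. e n < a" "\<And>b. b < a \<Longrightarrow> \<exists>n. b \<le> e n"
  shows "cofinality a \<le> omega"
proof -
  define i where "i n = (osuc ^^ n) (0 :: 'a ordinal)" for n
  have "inj i"
    by (rule strict_mono_imp_inj_on) (simp add: strict_mono_Suc_iff i_def osuc_greater)
  \<comment> \<open>\<open>cofinality\<close> asks for a function on ordinals, so \<open>e\<close>
    is transported along the finite ordinals. Off the range of \<open>i\<close> the value is still a
    term of \<open>e\<close>, hence below \<open>a\<close>.\<close>
  define f where "f c = e (inv i c)" for c
  have "f ` {..<omega} \<subseteq> {..<a}" using assms(1) by (auto simp: f_def)
  moreover have "\<exists>c < omega. b \<le> f c" if "b < a" for b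
  proof -
    obtain n where "b \<le> e n" using assms(2)[OF \<open>b < a\<close>] ..
    then show ?thesis
      using finite_iterate_less_omega[of n] inv_f_f[OF \<open>inj i\<close>, of n]
      by (intro exI[of _ "i n"]) (simp add: f_def i_def)
  qed
  ultimately have "\<exists>f :: 'a ordinal \<Rightarrow> 'a ordinal.
      f ` {..<omega} \<subseteq> {..<a} \<and> (\<forall>b<a. \<exists>c < omega. b \<le> f c)"
    by blast
  then show ?thesis unfolding cofinality_def by (rule Least_le)
qed

section \<open>Club sets and countable intersections\<close>

lemma club_in_lessThan: "club_in {..<a} a"
  unfolding club_in_def by auto

lemma club_in_INT:
  fixes C :: "nat \<Rightarrow> 'a ordinal set"
  assumes a: "omega < cofinality a" and C: "\<And>n. club_in (C n) a"
  shows "club_in (\<Inter>n. C n) a"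
proof -
  \<comment> \<open>The form in which uncountable cofinality is used: sequences below
    \<open>a\<close> are strictly bounded below \<open>a\<close>.\<close>
  have not_cofinal: "\<exists>b<a. \<forall>n. e n < b" if "\<And>n. e n < a" for e :: "nat \<Rightarrow> 'a ordinal"
    using cofinality_le_omega[of e a, OF that] a by (meson leD not_le)
  have next_point: "\<exists>c. c \<in> C n \<and> b < c \<and> c < a" if "b < a" for b n
  proof -
    obtain b' where "b < b'" "b' < a" using not_cofinal[of "\<lambda>_. b"] \<open>b < a\<close> by blast
    moreover obtain c where "c \<in> C n" "b' \<le> c"
      using C[of n] \<open>b' < a\<close> unfolding club_in_def by blast
    moreover have "c < a" using C[of n] \<open>c \<in> C n\<close> unfolding club_in_def by blast
    ultimately show ?thesis using less_le_trans by blast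
  qed
  have unbounded: "\<exists>c\<in>\<Inter>n. C n. b \<le> c" if "b < a" for b
  proof -
    \<comment> \<open>The sequence visits each \<open>C k\<close> infinitely often, so its supremum is a limit point of each.\<close>
    define nx where "nx n d = (SOME c. c \<in> C (fst (prod_decode n)) \<and> d < c \<and> c < a)" for n d
    have nx: "nx n d \<in> C (fst (prod_decode n)) \<and> d < nx n d \<and> nx n d < a" if "d < a" for n d
      unfolding nx_def by (rule someI_ex) (rule next_point[OF that])
    define e where "e = rec_nat b nx"
    have e_Suc: "e (Suc n) = nx n (e n)" for n by (simp add: e_def)
    have e_less: "e n < a" for n
      by (induction n) (use that nx e_Suc in \<open>auto simp: e_def\<close>)
    have e: "e (Suc n) \<in> C (fst (prod_decode n))" "e n < e (Suc n)" for n
      using nx[OF e_less] e_Suc by auto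
    have mono: "e m \<le> e n" if "m \<le> n" for m n
      using that e(2) by (simp add: lift_Suc_mono_le less_imp_le)
    let ?s = "strict_sup e"
    have "?s < a"
      using not_cofinal[OF e_less] strict_sup_le[of e] by (meson le_less_trans)
    have "?s \<in> C k" for k
    proof -
      have "\<exists>d\<in>C k. c \<le> d \<and> d < ?s" if "c < ?s" for c
      proof -
        obtain n where n: "c \<le> e n"
          using strict_sup_le[of e c] \<open>c < ?s\<close> by (meson not_le)
        \<comment> \<open>The step after stage \<open>prod_encode (k, n)\<close> lands in
          \<open>C k\<close>, and this stage is at least \<open>n\<close>; so \<open>C k\<close> is
          visited beyond any given term.\<close>
        have "n \<le> Suc (prod_encode (k, n))" using le_prod_encode_2[of n k] by simp
        then have "c \<le> e (Suc (prod_encode (k, n)))" using n mono order_trans by blast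
        moreover have "e (Suc (prod_encode (k, n))) \<in> C k"
          using e(1)[of "prod_encode (k, n)"] by simp
        ultimately show ?thesis using less_strict_sup by blast
      qed
      then show ?thesis
        using C[of k] \<open>?s < a\<close> is_limit_strict_sup[of e] e(2) unfolding club_in_def by blast
    qed
    moreover have "b \<le> ?s"
      using less_strict_sup[of e 0] by (simp add: e_def)
    ultimately show ?thesis by blast
  qed
  show ?thesis
    unfolding club_in_def
  proof (intro conjI allI impI)
    show "(\<Inter>n. C n) \<subseteq> {..<a}" using C[of 0] unfolding club_in_def by blast
    show "\<exists>c\<in>\<Inter>n. C n. b \<le> c" if "b < a" for b using unbounded[OF that] .
    show "b \<in> (\<Inter>n. C n)"
      if "b < a" "is_limit b \<and> (\<forall>c<b. \<exists>e\<in>\<Inter>n. C n. c \<le> e \<and> e < b)" for b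
    proof
      show "b \<in> C n" for n
        using C[of n] that unfolding club_in_def by (metis INT_iff UNIV_I)
    qed
  qed
qed

text \<open>The predicate inside \<open>club_topology\<close>, named so that closure under countable
  intersections can be proved before it is known to be a topology.\<close>

definition club_open :: "'a ordinal \<Rightarrow> 'a ordinal set \<Rightarrow> bool" where
  "club_open \<Theta> U \<longleftrightarrow> U \<subseteq> {..<\<Theta>} \<and>
    (\<forall>a\<in>U. omega < cofinality a \<longrightarrow> (\<exists>C. club_in C a \<and> C \<subseteq> U \<inter> {..<a}))"

lemma club_open_INT:
  fixes U :: "nat \<Rightarrow> 'a ordinal set"
  assumes "\<And>n. club_open \<Theta> (U n)"
  shows "club_open \<Theta> (\<Inter>n. U n)"
  unfolding club_open_def
proof (intro conjI ballI impI)
  show "(\<Inter>n. U n) \<subseteq> {..<\<Theta>}" using assms[of 0] unfolding club_open_def by blast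
  fix a assume a: "a \<in> (\<Inter>n. U n)" "omega < cofinality a"
  then have "\<forall>n. \<exists>C. club_in C a \<and> C \<subseteq> U n \<inter> {..<a}"
    using assms unfolding club_open_def by blast
  then obtain C where "\<And>n. club_in (C n) a" "\<And>n. C n \<subseteq> U n \<inter> {..<a}" by metis
  then show "\<exists>C. club_in C a \<and> C \<subseteq> (\<Inter>n. U n) \<inter> {..<a}"
    using club_in_INT[OF a(2), of C] by (intro exI[of _ "\<Inter>n. C n"]) blast
qed

lemma openin_club_topology: "openin (club_topology \<Theta>) = club_open \<Theta>"
proof -
  have "istopology (club_open \<Theta>)"
    unfolding istopology_def
  proof (intro conjI allI impI)
    fix S T assume "club_open \<Theta> S" "club_open \<Theta> T"
    \<comment> \<open>Binary intersections are the countable ones along the sequence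
      \<open>S, T, T, ...\<close>.\<close>
    then have "club_open \<Theta> (\<Inter>n::nat. if n = 0 then S else T)"
      by (intro club_open_INT) simp
    moreover have "(\<Inter>n::nat. if n = 0 then S else T) = S \<inter> T" by (auto split: if_splits)
    ultimately show "club_open \<Theta> (S \<inter> T)" by simp
  next
    fix F assume "\<forall>S\<in>F. club_open \<Theta> S"
    then show "club_open \<Theta> (\<Union>F)"
      unfolding club_open_def by (meson Int_mono Union_iff Union_least Union_upper order_refl subset_trans)
  qed
  then show ?thesis unfolding club_topology_def club_open_def[symmetric, abs_def]
    by (rule topology_inverse')
qed

lemma club_open_atMost: "y < \<Theta> \<Longrightarrow> club_open \<Theta> {..y}"
  unfolding club_open_def using club_in_lessThan by (force intro!: exI[of _ "{..<_}"])

lemma topspace_club_topology: "topspace (club_topology \<Theta>) = {..<\<Theta>}"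
proof -
  have "club_open \<Theta> {..<\<Theta>}"
    unfolding club_open_def using club_in_lessThan by (force intro!: exI[of _ "{..<_}"])
  then have "openin (club_topology \<Theta>) {..<\<Theta>}" by (simp add: openin_club_topology)
  moreover have "topspace (club_topology \<Theta>) \<subseteq> {..<\<Theta>}"
    using openin_topspace[of "club_topology \<Theta>"] unfolding openin_club_topology club_open_def by blast
  ultimately show ?thesis using openin_subset by blast
qed

section \<open>The two spaces\<close>

text \<open>Open sets of the left topology are downward closed, so \<open>{..x}\<close> is the least
  neighbourhood of \<open>x\<close> and lies in every intersection of neighbourhoods.\<close>

lemma left_topology_atMost_subset:
  assumes "openin (left_topology \<Theta>) U" "x \<in> U"
  shows "{..x} \<subseteq> U"
proof -
  have "generate_topology_on {{..\<beta>} | \<beta>. \<beta> < \<Theta>} U"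
    using assms(1) unfolding left_topology_def by (rule openin_topology_generated_by)
  then show ?thesis using assms(2) by (induction rule: generate_topology_on.induct) auto
qed

theorem theorem1p1:
  fixes lam :: "'a ordinal" and r :: "'i rel" and p :: "'i \<Rightarrow> 'v"
  assumes "r =o cardSuc (ctwo ^c ( |{..<lam}| +c natLeq))"
    and "inj_on p (Field r)"
  shows "(\<forall>\<Theta> :: 'a ordinal. \<not> satisfiable (icard_topology lam \<Theta>) (Gamma_fms r p)) \<and>
    (\<forall>\<Theta> :: 'a ordinal. \<not> satisfiable (club_plus_topology lam \<Theta>) (Gamma_fms r p))"
proof (intro conjI allI)
  fix \<Theta> :: "'a ordinal"
  have left: "openin (left_topology \<Theta>) {..y}" if "y < \<Theta>" for y
    using that unfolding left_topology_def by (auto intro: topology_generated_by_Basis)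
  show "\<not> satisfiable (icard_topology lam \<Theta>) (Gamma_fms r p)"
    unfolding icard_topology_def
  proof (rule not_satisfiable_Gamma_with_hyperlog_intervals[OF assms(1)])
    show "topspace (left_topology \<Theta>) = {..<\<Theta>}"
      unfolding left_topology_def topology_generated_by_topspace by auto
    show "coherent_nbhds (left_topology \<Theta>) x (\<lambda>W. openin (left_topology \<Theta>) W \<and> x \<in> W)"
      if "x < \<Theta>" for x
      unfolding coherent_nbhds_def using left[OF that] left_topology_atMost_subset
      by (intro allI impI exI[of _ "{..x}"]) blast
  qed (rule left)
  show "\<not> satisfiable (club_plus_topology lam \<Theta>) (Gamma_fms r p)"
    unfolding club_plus_topology_def
  proof (rule not_satisfiable_Gamma_with_hyperlog_intervals[OF assms(1)])
    show "coherent_nbhds (club_topology \<Theta>) x (\<lambda>W. openin (club_topology \<Theta>) W \<and> x \<in> W)" for x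
      unfolding coherent_nbhds_def openin_club_topology
    proof (intro allI impI)
      fix W :: "nat \<Rightarrow> 'a ordinal set"
      assume "\<forall>n. club_open \<Theta> (W n) \<and> x \<in> W n"
      then show "\<exists>V. club_open \<Theta> V \<and> x \<in> V \<and> (\<forall>n. V \<subseteq> W n)"
        by (intro exI[of _ "\<Inter>n. W n"]) (auto intro: club_open_INT)
    qed
  qed (simp_all add: topspace_club_topology openin_club_topology club_open_atMost)
qed

end
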